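(* In the polynomial ring $\mathbb R[x_0,\dots,x_7]$, with $H_3$, $m$, $k$, $z_0,\dots,z_7$ as defined in the context, the following identity holds: $$\begin{aligned} mk\,H_3(x)=\ &(m+k)^2\Bigl[k^2(x_0x_3-x_1x_2)^2+m^2(x_4x_7-x_5x_6)^2+2mk(x_0x_3x_4x_7+x_1x_2x_5x_6)\Bigr]\\ &+(m+k)\Bigl[(kz_0z_2+mz_4z_6)(z_1z_7-z_3z_5)^2+(kz_1z_3+mz_5z_7)(z_0z_6-z_2z_4)^2\Bigr]\\ &+(z_0z_6-z_2z_4)^2(z_1z_7-z_3z_5)^2 . \end{aligned}$$
   Context: Let $m=x_0+x_1+x_2+x_3$, $k=x_4+x_5+x_6+x_7$, and $$z_0=x_0+x_1,\ z_1=x_0+x_2,\ z_2=x_2+x_3,\ z_3=x_1+x_3,\ z_4=x_4+x_5,\ z_5=x_4+x_6,\ z_6=x_6+x_7,\ z_7=x_5+x_7.$$ The 3-dimensional hypercube polynomial is $H_3(x)=h^+(x)-h^-(x)$, where $$h^+(x)=\Bigl(\sum_{i=0}^{3}x_i\Bigr)\Bigl(\sum_{i=4}^{7}x_i\Bigr)\Bigl(\sum_{i\in\{0,2,4,6\}}x_i\Bigr)\Bigl(\sum_{i\in\{1,3,5,7\}}x_i\Bigr)\Bigl(\sum_{i\in\{0,1,4,5\}}x_i\Bigr)\Bigl(\sum_{i\in\{2,3,6,7\}}x_i\Bigr),$$ $$\begin{aligned} h^-(x)=\Bigl(\sum_{i=0}^{7}x_i\Bigr)^2\Bigl[&\Bigl(\sum_{i=0}^{3}x_i\Bigr)\Bigl(\sum_{4\le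 i<j<l\le 7}x_ix_jx_l\Bigr)+\Bigl(\sum_{i=4}^{7}x_i\Bigr)\Bigl(\sum_{0\le i<j<l\le 3}x_ix_jx_l\Bigr)\\ &+(x_0+x_1)(x_2+x_3)(x_4x_5+x_6x_7)+(x_0+x_2)(x_1+x_3)(x_4x_6+x_5x_7)\\ &+(x_0+x_3)(x_1+x_2)(x_5x_6+x_4x_7)+2x_0x_3x_5x_6+2x_1x_2x_4x_7\Bigr]. \end{aligned}$$ *)

theory Defs
  imports Complex_Main "HOL-Library.Poly_Mapping" "HOL-Library.Numeral_Type"
begin

text \<open>
  The ring of real polynomials in eight indeterminates, as finitely supported functions from
  monomials to coefficients. Monomials are exponent vectors over the eight-element
  index type; the ring operations are those of \<^theory>\<open>HOL-Library.Poly_Mapping\<close>.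
\<close>

type_synonym rpoly8 = "(8 \<Rightarrow>\<^sub>0 nat) \<Rightarrow>\<^sub>0 real"

text \<open>
  Indices are natural numbers, so that index ranges are the usual ones on \<^typ>\<open>nat\<close>. They are
  reduced modulo 8 by \<^const>\<open>of_nat\<close>; only the indices below 8 are ever used.
\<close>

definition X :: "nat \<Rightarrow> rpoly8" where
  "X i = Poly_Mapping.single (Poly_Mapping.single (of_nat i) 1) 1"

lemma inj_on_X: "inj_on X {..<8}"
proof (rule inj_onI)
  fix i j :: nat
  assume ij: "i \<in> {..<8}" "j \<in> {..<8}" and eq: "X i = X j"
  have "Poly_Mapping.single (of_nat i :: 8) (1 :: nat) = Poly_Mapping.single (of_nat j) 1"
    using arg_cong[OF eq, of Poly_Mapping.keys] by (simp add: X_def)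
  then have "Poly_Mapping.keys (Poly_Mapping.single (of_nat i :: 8) (1 :: nat))
    = Poly_Mapping.keys (Poly_Mapping.single (of_nat j) (1 :: nat))"
    by (simp only:)
  then have "(of_nat i :: 8) = of_nat j"
    by simp
  from arg_cong[OF this, of Rep_bit0] have "int i mod 8 = int j mod 8"
    by (simp add: bit0.of_nat_eq bit0.Rep_Abs_mod[where 'a = 4, simplified])
  then show "i = j" using ij by simp
qed

definition h_plus :: rpoly8 where
  "h_plus =
     (\<Sum>i=0..3. X i) * (\<Sum>i=4..7. X i) *
     (\<Sum>i\<in>{0,2,4,6}. X i) * (\<Sum>i\<in>{1,3,5,7}. X i) *
     (\<Sum>i\<in>{0,1,4,5}. X i) * (\<Sum>i\<in>{2,3,6,7}. X i)"

definition h_minus :: rpoly8 where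
  "h_minus =
     (\<Sum>i=0..7. X i)^2 *
     ((\<Sum>i=0..3. X i) * (\<Sum>i=4..7. \<Sum>j\<in>{i<..7}. \<Sum>l\<in>{j<..7}. X i * X j * X l)
      + (\<Sum>i=4..7. X i) * (\<Sum>i=0..3. \<Sum>j\<in>{i<..3}. \<Sum>l\<in>{j<..3}. X i * X j * X l)
      + (X 0 + X 1) * (X 2 + X 3) * (X 4 * X 5 + X 6 * X 7)
      + (X 0 + X 2) * (X 1 + X 3) * (X 4 * X 6 + X 5 * X 7)
      + (X 0 + X 3) * (X 1 + X 2) * (X 5 * X 6 + X 4 * X 7)
      + 2 * X 0 * X 3 * X 5 * X 6 + 2 * X 1 * X 2 * X 4 * X 7)"

definition H3 :: rpoly8 where
  "H3 = h_plus - h_minus"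

end

(*
  With P = k z0 z2 + m z4 z6, Q = k z1 z3 + m z5 z7, A = z0 z6 - z2 z4 and B = z1 z7 - z3 z5,
  the product h_plus satisfies m k h_plus = ((m + k) P + A^2) ((m + k) Q + B^2). The last three
  terms of the expansion are those of the claim, so it remains to split (m + k)^2 P Q. There the
  coefficient of k^2 is z0 z1 z2 z3 = (x0 x3 - x1 x2)^2 + m e3(x0,...,x3), symmetrically for m^2,
  and the mixed term of m k is a sum of products of two factors of degree two.
*)
theory Submission
  imports Defs
begin

text \<open>With z0, z2, z4, z6 or z1, z3, z5, z7 for a, b, c, d, the sums a + b and c + d are m and
  k, while a + c and b + d are two complementary factors of \<open>h_plus\<close>. One identity thus
  serves both pairs.\<close>

lemma four_linear_factors:
  fixes a b c d :: "'a::comm_ring_1"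
  shows "(a + b) * (c + d) * ((a + c) * (b + d)) =
    (a + b + (c + d)) * ((c + d) * a * b + (a + b) * c * d) + (a * d - b * c)^2"
  by (simp add: algebra_simps power2_eq_square)

text \<open>Same identity as before: (c + d)ab + (a + b)cd is the third elementary symmetric
  polynomial, written here as the triple sum occurring in \<open>h_minus\<close>.\<close>

lemma pair_sums_product:
  fixes a b c d :: "'a::comm_ring_1"
  shows "(a + b) * (c + d) * ((a + c) * (b + d)) =
    (a * d - b * c)^2 + (a + b + c + d) * (a * b * c + a * b * d + a * c * d + b * c * d)"
  by (simp add: algebra_simps power2_eq_square)

text \<open>Split (p + r)(q + s) = (pq + rs) + (ps + qr) and (p + q)(r + s) = (pr + qs) + (ps + qr).
  The common part ps + qr gets the coefficient (a + b)(c + d) + (a + c)(b + d) = (a + d)(b + c) +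
  2ad + 2bc.\<close>

lemma mixed_pair_sums:
  fixes a b c d p q r s :: "'a::comm_ring_1"
  shows "(a + b) * (c + d) * ((p + r) * (q + s)) + (a + c) * (b + d) * ((p + q) * (r + s)) =
    2 * (a * d * p * s + b * c * q * r)
    + ((a + b) * (c + d) * (p * q + r * s) + (a + c) * (b + d) * (p * r + q * s)
       + (a + d) * (b + c) * (q * r + p * s) + 2 * a * d * q * r + 2 * b * c * p * s)"
  by (simp add: algebra_simps)

lemma h_plus_eq:
  "h_plus = (X 0 + X 1 + X 2 + X 3) * (X 4 + X 5 + X 6 + X 7)
    * ((X 0 + X 2 + (X 4 + X 6)) * (X 1 + X 3 + (X 5 + X 7)))
    * ((X 0 + X 1 + (X 4 + X 5)) * (X 2 + X 3 + (X 6 + X 7)))"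
proof -
  have "{0..3::nat} = {0,1,2,3}" "{4..7::nat} = {4,5,6,7}" by auto
  then show ?thesis unfolding h_plus_def by (simp add: mult.assoc add.assoc)
qed

lemma h_minus_eq:
  "h_minus = (X 0 + X 1 + X 2 + X 3 + (X 4 + X 5 + X 6 + X 7))^2 *
    ((X 0 + X 1 + X 2 + X 3)
       * (X 4 * X 5 * X 6 + X 4 * X 5 * X 7 + X 4 * X 6 * X 7 + X 5 * X 6 * X 7)
     + (X 4 + X 5 + X 6 + X 7)
       * (X 0 * X 1 * X 2 + X 0 * X 1 * X 3 + X 0 * X 2 * X 3 + X 1 * X 2 * X 3)
     + ((X 0 + X 1) * (X 2 + X 3) * (X 4 * X 5 + X 6 * X 7)
        + (X 0 + X 2) * (X 1 + X 3) * (X 4 * X 6 + X 5 * X 7)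
        + (X 0 + X 3) * (X 1 + X 2) * (X 5 * X 6 + X 4 * X 7)
        + 2 * X 0 * X 3 * X 5 * X 6 + 2 * X 1 * X 2 * X 4 * X 7))"
proof -
  \<comment> \<open>The range above 1 is listed twice because simp rewrites \<open>1\<close> to
    \<open>Suc 0\<close>.\<close>
  have "{0..3::nat} = {0,1,2,3}" "{4..7::nat} = {4,5,6,7}" "{0..7::nat} = {0,1,2,3,4,5,6,7}"
    "{0<..3::nat} = {1,2,3}" "{1<..3::nat} = {2,3}" "{Suc 0<..3::nat} = {2,3}"
    "{2<..3::nat} = {3}"
    "{4<..7::nat} = {5,6,7}" "{5<..7::nat} = {6,7}" "{6<..7::nat} = {7}"
    by auto
  then show ?thesis unfolding h_minus_def by (simp add: add.assoc)
qed

text \<open>Opaque letters avoid an expansion in eight indeterminates: U and V stand for the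
  complementary pairs in \<open>h_plus\<close>, e and e' for the triple sums, c for the rest of the
  bracket in \<open>h_minus\<close>.\<close>

lemma combine_factorizations:
  fixes m k :: "'a::comm_ring_1"
  assumes H: "H = m * k * U * V - (m + k)^2 * (m * e' + k * e + c)"
    and V: "m * k * V = (m + k) * (k * z0 * z2 + m * z4 * z6) + A^2"
    and U: "m * k * U = (m + k) * (k * z1 * z3 + m * z5 * z7) + B^2"
    and e: "z0 * z2 * (z1 * z3) = a + m * e"
    and e': "z4 * z6 * (z5 * z7) = b + k * e'"
    and c: "z0 * z2 * (z5 * z7) + z1 * z3 * (z4 * z6) = 2 * d + c"
  shows "m * k * H = (m + k)^2 * (k^2 * a + m^2 * b + 2 * m * k * d)
    + (m + k) * ((k * z0 * z2 + m * z4 * z6) * B^2 + (k * z1 * z3 + m * z5 * z7) * A^2)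
    + A^2 * B^2"
proof -
  define P Q where "P = k * z0 * z2 + m * z4 * z6" and "Q = k * z1 * z3 + m * z5 * z7"
  have "P * Q = k^2 * (z0 * z2 * (z1 * z3)) + m^2 * (z4 * z6 * (z5 * z7))
      + m * k * (z0 * z2 * (z5 * z7) + z1 * z3 * (z4 * z6))"
    unfolding P_def Q_def by (simp add: algebra_simps power2_eq_square)
  \<comment> \<open>Both k^2 m e and m^2 k e' contain mk, so the whole bracket of
    \<open>h_minus\<close> appears with factor mk, ready to cancel.\<close>
  also have "\<dots> = k^2 * a + m^2 * b + 2 * m * k * d + m * k * (m * e' + k * e + c)"
    unfolding e e' c by (simp add: algebra_simps power2_eq_square)
  finally have PQ: "P * Q = \<dots>" .
  \<comment> \<open>H already contains one factor mk; the second lets U and V have one each.\<close>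
  have "m * k * H = (m * k * V) * (m * k * U) - (m + k)^2 * (m * k * (m * e' + k * e + c))"
    unfolding H by (simp add: algebra_simps)
  also have "\<dots> = (m + k)^2 * (P * Q - m * k * (m * e' + k * e + c))
      + (m + k) * (P * B^2 + Q * A^2) + A^2 * B^2"
    unfolding U V P_def[symmetric] Q_def[symmetric]
    by (simp add: algebra_simps power2_eq_square)
  finally show ?thesis unfolding PQ by (simp add: P_def Q_def)
qed

theorem mainTheorem9:
  shows "let m = X 0 + X 1 + X 2 + X 3;
             k = X 4 + X 5 + X 6 + X 7;
             z0 = X 0 + X 1;
             z1 = X 0 + X 2;
             z2 = X 2 + X 3;
             z3 = X 1 + X 3;
             z4 = X 4 + X 5;
             z5 = X 4 + X 6;
             z6 = X 6 + X 7;
             z7 = X 5 + X 7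
         in m * k * H3 =
              (m + k)^2 *
                (k^2 * (X 0 * X 3 - X 1 * X 2)^2 + m^2 * (X 4 * X 7 - X 5 * X 6)^2
                 + 2 * m * k * (X 0 * X 3 * X 4 * X 7 + X 1 * X 2 * X 5 * X 6))
              + (m + k) *
                ((k * z0 * z2 + m * z4 * z6) * (z1 * z7 - z3 * z5)^2
                 + (k * z1 * z3 + m * z5 * z7) * (z0 * z6 - z2 * z4)^2)
              + (z0 * z6 - z2 * z4)^2 * (z1 * z7 - z3 * z5)^2"
  unfolding Let_def
proof (rule combine_factorizations)
  \<comment> \<open>The goal does not determine U, V, e, e' and c; this equation instantiates
    them.\<close>
  show "H3 = (X 0 + X 1 + X 2 + X 3) * (X 4 + X 5 + X 6 + X 7)
      * ((X 0 + X 2 + (X 4 + X 6)) * (X 1 + X 3 + (X 5 + X 7)))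
      * ((X 0 + X 1 + (X 4 + X 5)) * (X 2 + X 3 + (X 6 + X 7)))
    - (X 0 + X 1 + X 2 + X 3 + (X 4 + X 5 + X 6 + X 7))^2 *
    ((X 0 + X 1 + X 2 + X 3)
       * (X 4 * X 5 * X 6 + X 4 * X 5 * X 7 + X 4 * X 6 * X 7 + X 5 * X 6 * X 7)
     + (X 4 + X 5 + X 6 + X 7)
       * (X 0 * X 1 * X 2 + X 0 * X 1 * X 3 + X 0 * X 2 * X 3 + X 1 * X 2 * X 3)
     + ((X 0 + X 1) * (X 2 + X 3) * (X 4 * X 5 + X 6 * X 7)
        + (X 0 + X 2) * (X 1 + X 3) * (X 4 * X 6 + X 5 * X 7)
        + (X 0 + X 3) * (X 1 + X 2) * (X 5 * X 6 + X 4 * X 7)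
        + 2 * X 0 * X 3 * X 5 * X 6 + 2 * X 1 * X 2 * X 4 * X 7))"
    unfolding H3_def h_plus_eq h_minus_eq ..
next
  show "(X 0 + X 1 + X 2 + X 3) * (X 4 + X 5 + X 6 + X 7)
      * ((X 0 + X 1 + (X 4 + X 5)) * (X 2 + X 3 + (X 6 + X 7))) =
    (X 0 + X 1 + X 2 + X 3 + (X 4 + X 5 + X 6 + X 7))
      * ((X 4 + X 5 + X 6 + X 7) * (X 0 + X 1) * (X 2 + X 3)
         + (X 0 + X 1 + X 2 + X 3) * (X 4 + X 5) * (X 6 + X 7))
    + ((X 0 + X 1) * (X 6 + X 7) - (X 2 + X 3) * (X 4 + X 5))^2"
    using four_linear_factors[of "X 0 + X 1" "X 2 + X 3" "X 4 + X 5" "X 6 + X 7"]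
    by (simp only: add.assoc)
next
  \<comment> \<open>z1 + z3 and z5 + z7 are m and k only after reordering.\<close>
  have sums: "X 0 + X 2 + (X 1 + X 3) = X 0 + X 1 + X 2 + X 3"
    "X 4 + X 6 + (X 5 + X 7) = X 4 + X 5 + X 6 + X 7"
    by (simp_all only: ac_simps)
  show "(X 0 + X 1 + X 2 + X 3) * (X 4 + X 5 + X 6 + X 7)
      * ((X 0 + X 2 + (X 4 + X 6)) * (X 1 + X 3 + (X 5 + X 7))) =
    (X 0 + X 1 + X 2 + X 3 + (X 4 + X 5 + X 6 + X 7))
      * ((X 4 + X 5 + X 6 + X 7) * (X 0 + X 2) * (X 1 + X 3)
         + (X 0 + X 1 + X 2 + X 3) * (X 4 + X 6) * (X 5 + X 7))
    + ((X 0 + X 2) * (X 5 + X 7) - (X 1 + X 3) * (X 4 + X 6))^2"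
    using four_linear_factors[of "X 0 + X 2" "X 1 + X 3" "X 4 + X 6" "X 5 + X 7"]
    unfolding sums .
qed (rule pair_sums_product mixed_pair_sums)+

end
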